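(* Consider the minimization over pairs $(\bm{v}_x,\bm{v}_y)\in\mathbb{R}^{n^2}\times\mathbb{R}^{n^2}$ of $$F[\bm{v}_x,\bm{v}_y]=(K_x\bm{v}_x,\bm{v}_x)+(K_y\bm{v}_y,\bm{v}_y)-2(B_y\bm{v}_y,\bm{f})$$ subject to the constraints $$B_x\bm{v}_x=B_y\bm{v}_y,\qquad S_x\bm{v}_x=0,\qquad S_y\bm{v}_y=0.$$ Define $$H_x=B_xR_x,\quad R_x=K_x^{-1}\left(I\otimes I-W_xK_x^{-1}\right)B_x^T,\quad W_x=Q_x\otimes E,$$ $$H_y=B_yR_y,\quad R_y=K_y^{-1}\left(I\otimes I-W_yK_y^{-1}\right)B_y^T,\quad W_y=E\otimes Q_y.$$ Then the constrained minimizer $(\bm{u}_x,\bm{u}_y)$ and the associated discrete solution $\bm{u}=B_x\bm{u}_x=B_y\bm{u}_y$ are given by $$\bm{u}_x=R_x\bm{\mu},\qquad \bm{u}_y=R_y(\bm{f}-\bm{\mu}),\qquad \bm{u}=H_x\bm{\mu},$$ where $\bm{\mu}\in\mathbb{R}^{n^2}$ is a solution of the linear system $$(H_x+H_y)\bm{\mu}=H_y\bm{f}.$$ (That is, this linear system has a solution, and for every solution $\bm{\mu}$ the formulas above give the minimizer and $\bm{u}$.)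
   Context: Let $d\in\mathbb{N}$, $n=2^d$, $h=1/n$. Indices start at $0$, and Kronecker products follow the convention $(A\otimes C)[in+k,\,jn+l]=A[i,j]\,C[k,l]$ for $n\times n$ matrices (and analogously for rectangular ones). $(\cdot,\cdot)$ is the Euclidean inner product. $I$ is the $n\times n$ identity matrix, $E$ the $n\times n$ matrix of ones, $\bm{e}\in\mathbb{R}^n$ the column vector of ones. $B$ is the $n\times n$ matrix with $B[i,j]=h$ if $i\ge j$ and $B[i,j]=0$ otherwise, and $$B_x=I\otimes B,\quad B_y=B\otimes I,\quad S_x=I\otimes\bm{e}^{\top},\quad S_y=\bm{e}^{\top}\otimes I.$$ The scheme discretizes $-\nabla\cdot(\mathcal{K}\nabla u)=f$ on $\Omega=[0,1]^2$ with $u|_{\partial\Omega}=0$, where $\mathcal{K}$ is diagonal with components $k_x,k_y$, functions on $\Omega$ with positive values. For $\alpha=0,\dots,n^2-1$ put $i(\alpha)=\alpha \bmod n$, $j(\alpha)=(\alpha-i(\alpha))/n$, and define vectors in $\mathbb{R}^{n^2}$ by $$\bm{f}[\alpha]=f\big((i(\alpha)+1)h,(j(\alpha)+1)h\big),$$ $$\bm{k}_x[\alpha]=k_x\big((i(\alpha)+\tfrac12)h,(j(\alpha)+1)h\big),\qquad \bm{k}_y[\alpha]=k_y\big((i(\alpha)+1)h,(j(\alpha)+\tfrac12)h\big).$$ $K_x=\mathrm{diag}(\bm{k}_x)$ and $K_y=\mathrm{diag}(\bm{k}_y)$ are $n^2\times n^2$ diagonal matrices. $Q_x=\mathrm{diag}(\bm{q}_x)$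 and $Q_y=\mathrm{diag}(\bm{q}_y)$ are the $n\times n$ diagonal matrices with $$\bm{q}_x[i]=\Big(\sum_{\alpha=0}^{n-1}\frac{1}{\bm{k}_x[in+\alpha]}\Big)^{-1},\qquad \bm{q}_y[i]=\Big(\sum_{\alpha=0}^{n-1}\frac{1}{\bm{k}_y[i+n\alpha]}\Big)^{-1},\qquad i=0,\dots,n-1.$$ *)

theory Defs
  imports Complex_Main "Jordan_Normal_Form.Gauss_Jordan_Elimination"
begin

definition Omega :: "(real \<times> real) set" where
  "Omega = {0..1} \<times> {0..1}"

definition mesh :: "nat \<Rightarrow> real" where
  "mesh n = 1 / real n"


definition kron :: "real mat \<Rightarrow> real mat \<Rightarrow> real mat" (infixl "\<otimes>\<^sub>K" 70) where
  "A \<otimes>\<^sub>K C = mat (dim_row A * dim_row C) (dim_col A * dim_col C)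
     (\<lambda>(r, s). A $$ (r div dim_row C, s div dim_col C) * C $$ (r mod dim_row C, s mod dim_col C))"

definition diag_of_vec :: "real vec \<Rightarrow> real mat" where
  "diag_of_vec v = mat_diag (dim_vec v) (\<lambda>i. v $ i)"

(* Underspecified for matrices that are not invertible. *)
definition minv :: "real mat \<Rightarrow> real mat" where
  "minv A = the (mat_inverse A)"

definition ones_mat :: "nat \<Rightarrow> real mat" where
  "ones_mat n = mat n n (\<lambda>_. 1)"

(* The column vector of ones, as an n x 1 matrix, so that it can enter a Kronecker product. *)
definition ones_col :: "nat \<Rightarrow> real mat" where
  "ones_col n = mat n 1 (\<lambda>_. 1)"

definition B_mat :: "nat \<Rightarrow> real mat" where
  "B_mat n = mat n n (\<lambda>(i, j). if i \<ge> j then mesh n else 0)"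

definition B_x :: "nat \<Rightarrow> real mat" where
  "B_x n = 1\<^sub>m n \<otimes>\<^sub>K B_mat n"

definition B_y :: "nat \<Rightarrow> real mat" where
  "B_y n = B_mat n \<otimes>\<^sub>K 1\<^sub>m n"

definition S_x :: "nat \<Rightarrow> real mat" where
  "S_x n = 1\<^sub>m n \<otimes>\<^sub>K transpose_mat (ones_col n)"

definition S_y :: "nat \<Rightarrow> real mat" where
  "S_y n = transpose_mat (ones_col n) \<otimes>\<^sub>K 1\<^sub>m n"


(* For a = 0, ..., n^2 - 1 the grid indices are i(a) = a mod n and
   j(a) = (a - i(a)) / n = a div n. *)

definition f_vec :: "nat \<Rightarrow> (real \<times> real \<Rightarrow> real) \<Rightarrow> real vec" where
  "f_vec n f = vec (n\<^sup>2)
     (\<lambda>a. f ((real (a mod n) + 1) * mesh n, (real (a div n) + 1) * mesh n))"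

definition k_x_vec :: "nat \<Rightarrow> (real \<times> real \<Rightarrow> real) \<Rightarrow> real vec" where
  "k_x_vec n k\<^sub>x = vec (n\<^sup>2)
     (\<lambda>a. k\<^sub>x ((real (a mod n) + 1/2) * mesh n, (real (a div n) + 1) * mesh n))"

definition k_y_vec :: "nat \<Rightarrow> (real \<times> real \<Rightarrow> real) \<Rightarrow> real vec" where
  "k_y_vec n k\<^sub>y = vec (n\<^sup>2)
     (\<lambda>a. k\<^sub>y ((real (a mod n) + 1) * mesh n, (real (a div n) + 1/2) * mesh n))"

definition K_x :: "nat \<Rightarrow> (real \<times> real \<Rightarrow> real) \<Rightarrow> real mat" where
  "K_x n k\<^sub>x = diag_of_vec (k_x_vec n k\<^sub>x)"

definition K_y :: "nat \<Rightarrow> (real \<times> real \<Rightarrow> real) \<Rightarrow> real mat" where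
  "K_y n k\<^sub>y = diag_of_vec (k_y_vec n k\<^sub>y)"

definition q_x_vec :: "nat \<Rightarrow> (real \<times> real \<Rightarrow> real) \<Rightarrow> real vec" where
  "q_x_vec n k\<^sub>x = vec n (\<lambda>i. inverse (\<Sum>a<n. 1 / k_x_vec n k\<^sub>x $ (i * n + a)))"

definition q_y_vec :: "nat \<Rightarrow> (real \<times> real \<Rightarrow> real) \<Rightarrow> real vec" where
  "q_y_vec n k\<^sub>y = vec n (\<lambda>i. inverse (\<Sum>a<n. 1 / k_y_vec n k\<^sub>y $ (i + n * a)))"

definition Q_x :: "nat \<Rightarrow> (real \<times> real \<Rightarrow> real) \<Rightarrow> real mat" where
  "Q_x n k\<^sub>x = diag_of_vec (q_x_vec n k\<^sub>x)"

definition Q_y :: "nat \<Rightarrow> (real \<times> real \<Rightarrow> real) \<Rightarrow> real mat" where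
  "Q_y n k\<^sub>y = diag_of_vec (q_y_vec n k\<^sub>y)"


definition W_x :: "nat \<Rightarrow> (real \<times> real \<Rightarrow> real) \<Rightarrow> real mat" where
  "W_x n k\<^sub>x = Q_x n k\<^sub>x \<otimes>\<^sub>K ones_mat n"

definition W_y :: "nat \<Rightarrow> (real \<times> real \<Rightarrow> real) \<Rightarrow> real mat" where
  "W_y n k\<^sub>y = ones_mat n \<otimes>\<^sub>K Q_y n k\<^sub>y"

definition R_x :: "nat \<Rightarrow> (real \<times> real \<Rightarrow> real) \<Rightarrow> real mat" where
  "R_x n k\<^sub>x = minv (K_x n k\<^sub>x) * (1\<^sub>m n \<otimes>\<^sub>K 1\<^sub>m n - W_x n k\<^sub>x * minv (K_x n k\<^sub>x))
     * transpose_mat (B_x n)"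

definition R_y :: "nat \<Rightarrow> (real \<times> real \<Rightarrow> real) \<Rightarrow> real mat" where
  "R_y n k\<^sub>y = minv (K_y n k\<^sub>y) * (1\<^sub>m n \<otimes>\<^sub>K 1\<^sub>m n - W_y n k\<^sub>y * minv (K_y n k\<^sub>y))
     * transpose_mat (B_y n)"

definition H_x :: "nat \<Rightarrow> (real \<times> real \<Rightarrow> real) \<Rightarrow> real mat" where
  "H_x n k\<^sub>x = B_x n * R_x n k\<^sub>x"

definition H_y :: "nat \<Rightarrow> (real \<times> real \<Rightarrow> real) \<Rightarrow> real mat" where
  "H_y n k\<^sub>y = B_y n * R_y n k\<^sub>y"


definition energy :: "nat \<Rightarrow> (real \<times> real \<Rightarrow> real) \<Rightarrow> (real \<times> real \<Rightarrow> real) \<Rightarrow>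
    (real \<times> real \<Rightarrow> real) \<Rightarrow> real vec \<times> real vec \<Rightarrow> real" where
  "energy n k\<^sub>x k\<^sub>y f = (\<lambda>(v\<^sub>x, v\<^sub>y).
     (K_x n k\<^sub>x *\<^sub>v v\<^sub>x) \<bullet> v\<^sub>x + (K_y n k\<^sub>y *\<^sub>v v\<^sub>y) \<bullet> v\<^sub>y
     - 2 * ((B_y n *\<^sub>v v\<^sub>y) \<bullet> f_vec n f))"

definition feasible :: "nat \<Rightarrow> real vec \<times> real vec \<Rightarrow> bool" where
  "feasible n = (\<lambda>(v\<^sub>x, v\<^sub>y).
     v\<^sub>x \<in> carrier_vec (n\<^sup>2) \<and> v\<^sub>y \<in> carrier_vec (n\<^sup>2) \<and>
     B_x n *\<^sub>v v\<^sub>x = B_y n *\<^sub>v v\<^sub>y \<and>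
     S_x n *\<^sub>v v\<^sub>x = 0\<^sub>v n \<and> S_y n *\<^sub>v v\<^sub>y = 0\<^sub>v n)"

end

theory Submission
  imports Defs
begin

text \<open>
  In each direction the matrix \<open>P = K\<^sup>-\<^sup>1 (I - W K\<^sup>-\<^sup>1)\<close> is symmetric, maps into the kernel of the
  constraint \<open>S\<close>, and satisfies \<open>P K v = v\<close> on that kernel. Hence
  \<open>(K P w, v) = (w, v)\<close> for all \<open>v\<close> in the kernel, which makes \<open>(R\<^sub>x \<mu>, R\<^sub>y (f - \<mu>))\<close> a stationary
  point of the energy, with \<open>\<mu>\<close> the multiplier of \<open>B\<^sub>x v\<^sub>x = B\<^sub>y v\<^sub>y\<close>; strict convexity does the rest.
  The matrix \<open>H\<^sub>x + H\<^sub>y\<close> is singular, but both summands are positive semidefinite, so its kernel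
  lies in the kernel of \<open>H\<^sub>y\<close>, and the Fredholm alternative yields a solution \<open>\<mu>\<close>.
\<close>

section \<open>Solvability of singular linear systems\<close>

text \<open>Gauss-Jordan elimination gives an invertible \<open>P\<close> with
  \<open>C = P * A\<close> in row echelon form, so it suffices to solve \<open>C x = P b\<close>.
  This is done by setting the free variables to zero and reading the pivot variables off
  \<open>P b\<close>; the orthogonality assumption makes \<open>P b\<close> vanish on the zero rows
  of \<open>C\<close>.\<close>

lemma fredholm_alternative:
  fixes A :: "'a::field mat"
  assumes A: "A \<in> carrier_mat nr nc" and b: "b \<in> carrier_vec nr"
    and orth: "\<And>z. \<lbrakk>z \<in> carrier_vec nr; transpose_mat A *\<^sub>v z = 0\<^sub>v nc\<rbrakk> \<Longrightarrow> z \<bullet> b = 0"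
  shows "\<exists>x\<in>carrier_vec nc. A *\<^sub>v x = b"
proof -
  define b' where "b' = mat nr 1 (\<lambda>(i, j). b $ i)"
  have b': "b' \<in> carrier_mat nr 1" by (simp add: b'_def)
  obtain C D where gj: "gauss_jordan A b' = (C, D)" by force
  obtain P where PU: "P \<in> Units (ring_mat TYPE('a) nr undefined)" and CP: "C = P * A"
    using gauss_jordan_transform[OF A b' gj, of undefined] by auto
  then obtain Q where P: "P \<in> carrier_mat nr nr" and Q: "Q \<in> carrier_mat nr nr"
    and QP: "Q * P = 1\<^sub>m nr"
    by (auto simp: Units_def ring_mat_def)
  have C: "C \<in> carrier_mat nr nc" using CP P A by simp
  obtain p where piv: "pivot_fun C p nc"
    using gauss_jordan_row_echelon[OF A gj] C by (auto simp: row_echelon_form_def)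
  have dC: "dim_row C = nr" using C by simp
  note pD = pivot_funD[OF dC piv]
  define d where "d = P *\<^sub>v b"
  have d: "d \<in> carrier_vec nr" using P b by (simp add: d_def)
  (* Each pivot column belongs to one row only, so the sum has at most one nonzero term. *)
  define x where "x = vec nc (\<lambda>j. \<Sum>i<nr. if p i = j then d $ i else 0)"
  have x: "x \<in> carrier_vec nc" by (simp add: x_def)
  \<comment> \<open>A row without a pivot is a zero row of \<open>P * A\<close>, so
    \<open>row P k\<close> lies in the kernel of the transpose of \<open>A\<close> and is a valid
    test vector for \<open>orth\<close>.\<close>
  have zero_row: "d $ k = 0" if k: "k < nr" and pk: "\<not> p k < nc" for k
  proof -
    have rk: "row P k \<in> carrier_vec nr" using P k by simp
    have "transpose_mat A *\<^sub>v row P k = 0\<^sub>v nc"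
    proof (rule eq_vecI)
      fix j assume "j < dim_vec (0\<^sub>v nc :: 'a vec)"
      then have j: "j < nc" by simp
      have "(transpose_mat A *\<^sub>v row P k) $ j = col A j \<bullet> row P k" using A j by simp
      also have "\<dots> = row P k \<bullet> col A j"
        using A rk j by (intro comm_scalar_prod[of _ nr]) auto
      also have "\<dots> = C $$ (k, j)" using CP A P j k by simp
      also have "\<dots> = 0" using pD(1)[OF k] pD(2)[OF k, of j] pk j by auto
      finally show "(transpose_mat A *\<^sub>v row P k) $ j = 0\<^sub>v nc $ j" using j by simp
    qed (use A in simp)
    from orth[OF rk this] show ?thesis using P k by (simp add: d_def)
  qed
  have "C *\<^sub>v x = d"
  proof (rule eq_vecI)
    fix k assume "k < dim_vec d"
    then have k: "k < nr" using d by simp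
    have "(C *\<^sub>v x) $ k = (\<Sum>j<nc. C $$ (k, j) * (\<Sum>i<nr. if p i = j then d $ i else 0))"
      using C k by (simp add: scalar_prod_def x_def lessThan_atLeast0)
    also have "\<dots> = (\<Sum>i<nr. \<Sum>j<nc. if p i = j then C $$ (k, j) * d $ i else 0)"
      unfolding sum_distrib_left by (subst sum.swap) (simp add: if_distrib cong: if_cong)
    also have "\<dots> = (\<Sum>i<nr. if p i < nc then C $$ (k, p i) * d $ i else 0)"
      by (intro sum.cong) auto
    \<comment> \<open>Pivot columns are unit vectors, so only \<open>i = k\<close> survives. If row
      \<open>k\<close> has no pivot, the left side is 0 and \<open>zero_row\<close> gives
      \<open>d $ k = 0\<close> as well.\<close>
    also have "\<dots> = (\<Sum>i<nr. if i = k then d $ k else 0)"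
    proof (intro sum.cong refl)
      fix i assume "i \<in> {..<nr}"
      then have i: "i < nr" by simp
      show "(if p i < nc then C $$ (k, p i) * d $ i else 0) = (if i = k then d $ k else 0)"
        using pD(4)[OF i] pD(5)[OF i _ k] zero_row[OF k] by auto
    qed
    also have "\<dots> = d $ k" using k by simp
    finally show "(C *\<^sub>v x) $ k = d $ k" .
  qed (use C d in simp)
  then have eq: "P *\<^sub>v (A *\<^sub>v x) = P *\<^sub>v b" using CP P A x by (simp add: d_def)
  have cancel: "Q *\<^sub>v (P *\<^sub>v y) = y" if "y \<in> carrier_vec nr" for y
    using assoc_mult_mat_vec[OF Q P that] QP that by simp
  have "A *\<^sub>v x \<in> carrier_vec nr" using A x by simp
  then have "A *\<^sub>v x = b" using cancel[OF b] cancel[of "A *\<^sub>v x"] unfolding eq by argo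
  with x show ?thesis by blast
qed

lemma eq_of_minus_eq_0:
  fixes v w :: "'a::group_add vec"
  assumes "v \<in> carrier_vec n" "w \<in> carrier_vec n" "v - w = 0\<^sub>v n"
  shows "v = w"
proof (rule eq_vecI)
  fix i assume "i < dim_vec w"
  then show "v $ i = w $ i" using arg_cong[OF assms(3), of "\<lambda>u. u $ i"] assms(1,2) by simp
qed (use assms in simp)

section \<open>Quadratic minimization on the kernel of a constraint\<close>

text \<open>These properties make \<open>P w\<close> the Riesz representative of the functional
  \<open>(w, .)\<close> on the kernel of \<open>S\<close>, with respect to the inner product
  \<open>(K ., .)\<close>.\<close>

locale constrained_inverse =
  fixes N m :: nat and K S P :: "real mat"
  assumes K: "K \<in> carrier_mat N N" and P: "P \<in> carrier_mat N N"
    and K_sym: "transpose_mat K = K" and P_sym: "transpose_mat P = P"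
    and K_pos: "\<lbrakk>v \<in> carrier_vec N; v \<noteq> 0\<^sub>v N\<rbrakk> \<Longrightarrow> 0 < (K *\<^sub>v v) \<bullet> v"
    and S_P: "v \<in> carrier_vec N \<Longrightarrow> S *\<^sub>v (P *\<^sub>v v) = 0\<^sub>v m"
    and P_K: "\<lbrakk>v \<in> carrier_vec N; S *\<^sub>v v = 0\<^sub>v m\<rbrakk> \<Longrightarrow> P *\<^sub>v (K *\<^sub>v v) = v"
begin

lemma K_nonneg: "v \<in> carrier_vec N \<Longrightarrow> 0 \<le> (K *\<^sub>v v) \<bullet> v"
  using K_pos[of v] K by (cases "v = 0\<^sub>v N") (auto simp: less_imp_le)

text \<open>By symmetry both \<open>K\<close> and \<open>P\<close> move to the other factor, where
  \<open>P K\<close> acts as the identity. This is the Euler-Lagrange equation: the residual of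
  \<open>P w\<close> is orthogonal to the kernel of \<open>S\<close>.\<close>

lemma stationary:
  assumes w: "w \<in> carrier_vec N" and v: "v \<in> carrier_vec N" and "S *\<^sub>v v = 0\<^sub>v m"
  shows "(K *\<^sub>v (P *\<^sub>v w)) \<bullet> v = w \<bullet> v"
proof -
  have "(K *\<^sub>v (P *\<^sub>v w)) \<bullet> v = (P *\<^sub>v w) \<bullet> (K *\<^sub>v v)"
    using transpose_vec_mult_scalar[OF K v, of "P *\<^sub>v w"] K_sym P w by simp
  also have "\<dots> = w \<bullet> (P *\<^sub>v (K *\<^sub>v v))"
    using transpose_vec_mult_scalar[OF P _ w, of "K *\<^sub>v v"] P_sym K v by simp
  finally show ?thesis using P_K[OF v assms(3)] by simp
qed

text \<open>The vector \<open>P w\<close> is itself a legitimate test vector in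
  \<open>stationary\<close>. The identity carries positivity from \<open>K\<close> to
  \<open>P\<close>: the form of \<open>P\<close> is nonnegative, and it vanishes only on the kernel
  of \<open>P\<close>.\<close>

lemma P_form:
  assumes "w \<in> carrier_vec N"
  shows "w \<bullet> (P *\<^sub>v w) = (K *\<^sub>v (P *\<^sub>v w)) \<bullet> (P *\<^sub>v w)"
  using stationary[OF assms, of "P *\<^sub>v w"] S_P[OF assms] P assms by simp

lemma P_form_nonneg: "w \<in> carrier_vec N \<Longrightarrow> 0 \<le> w \<bullet> (P *\<^sub>v w)"
  using P_form[of w] K_nonneg[of "P *\<^sub>v w"] P by simp

lemma P_form_eq_0D:
  assumes "w \<in> carrier_vec N" "w \<bullet> (P *\<^sub>v w) = 0"
  shows "P *\<^sub>v w = 0\<^sub>v N"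
  using P_form[OF assms(1)] K_pos[of "P *\<^sub>v w"] P assms by auto

text \<open>Taylor expansion about \<open>u\<close>, exact for a quadratic form; symmetry of
  \<open>K\<close> merges the two cross terms.\<close>

lemma K_form_expand:
  assumes u: "u \<in> carrier_vec N" and v: "v \<in> carrier_vec N"
  shows "(K *\<^sub>v v) \<bullet> v =
    (K *\<^sub>v u) \<bullet> u + 2 * ((K *\<^sub>v u) \<bullet> (v - u)) + (K *\<^sub>v (v - u)) \<bullet> (v - u)"
proof -
  have sym: "(K *\<^sub>v v) \<bullet> u = (K *\<^sub>v u) \<bullet> v"
    using transpose_vec_mult_scalar[OF K u v] K_sym comm_scalar_prod[of v N "K *\<^sub>v u"] K u v
    by simp
  have c: "K *\<^sub>v u \<in> carrier_vec N" "K *\<^sub>v v \<in> carrier_vec N" using K u v by auto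
  show ?thesis
    using sym c u v
    by (simp add: mult_minus_distrib_mat_vec[OF K v u] scalar_prod_minus_distrib[of _ N]
        minus_scalar_prod_distrib[of _ N])
qed

end

section \<open>Two constrained problems coupled by a multiplier\<close>

text \<open>The grid is forgotten here: each direction contributes only a constrained inverse and a
  square coupling matrix. Index 1 stands for x and index 2 for y.\<close>

locale coupled_minimization =
  X: constrained_inverse N m K1 S1 P1 + Y: constrained_inverse N m K2 S2 P2
  for N m :: nat and K1 S1 P1 K2 S2 P2 :: "real mat" +
  fixes B1 B2 :: "real mat" and f :: "real vec"
  assumes B1: "B1 \<in> carrier_mat N N" and B2: "B2 \<in> carrier_mat N N" and f: "f \<in> carrier_vec N"
    and S1: "S1 \<in> carrier_mat m N" and S2: "S2 \<in> carrier_mat m N"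
begin

definition R1 where "R1 = P1 * transpose_mat B1"
definition R2 where "R2 = P2 * transpose_mat B2"
definition H where "H = B1 * R1 + B2 * R2"

definition F :: "real vec \<times> real vec \<Rightarrow> real" where
  "F = (\<lambda>(v, w). (K1 *\<^sub>v v) \<bullet> v + (K2 *\<^sub>v w) \<bullet> w - 2 * ((B2 *\<^sub>v w) \<bullet> f))"

definition admissible :: "real vec \<times> real vec \<Rightarrow> bool" where
  "admissible = (\<lambda>(v, w). v \<in> carrier_vec N \<and> w \<in> carrier_vec N \<and>
     B1 *\<^sub>v v = B2 *\<^sub>v w \<and> S1 *\<^sub>v v = 0\<^sub>v m \<and> S2 *\<^sub>v w = 0\<^sub>v m)"

lemma R1: "R1 \<in> carrier_mat N N" and R2: "R2 \<in> carrier_mat N N" and H: "H \<in> carrier_mat N N"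
  using X.P Y.P B1 B2 by (auto simp: R1_def R2_def H_def)

lemma R1_apply: "z \<in> carrier_vec N \<Longrightarrow> R1 *\<^sub>v z = P1 *\<^sub>v (transpose_mat B1 *\<^sub>v z)"
  and R2_apply: "z \<in> carrier_vec N \<Longrightarrow> R2 *\<^sub>v z = P2 *\<^sub>v (transpose_mat B2 *\<^sub>v z)"
  using X.P Y.P B1 B2
  by (auto simp: R1_def R2_def intro!: assoc_mult_mat_vec[of _ N N _ N])

lemma H_apply: "z \<in> carrier_vec N \<Longrightarrow> H *\<^sub>v z = B1 *\<^sub>v (R1 *\<^sub>v z) + B2 *\<^sub>v (R2 *\<^sub>v z)"
  using B1 B2 R1 R2 unfolding H_def by (subst add_mult_distrib_mat_vec[of _ N N]) auto

lemma transpose_scalar: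
  assumes "B \<in> carrier_mat N N" "z \<in> carrier_vec N" "v \<in> carrier_vec N"
  shows "z \<bullet> (B *\<^sub>v v) = (transpose_mat B *\<^sub>v z) \<bullet> (v :: real vec)"
  using transpose_vec_mult_scalar[OF assms(1,3,2)] by simp

lemma multiplier_exists: "\<exists>z\<in>carrier_vec N. H *\<^sub>v z = B2 *\<^sub>v (R2 *\<^sub>v f)"
proof (rule fredholm_alternative[OF H])
  show "B2 *\<^sub>v (R2 *\<^sub>v f) \<in> carrier_vec N" using B2 R2 f by simp
next
  fix z assume z: "z \<in> carrier_vec N" and "transpose_mat H *\<^sub>v z = 0\<^sub>v N"
  \<comment> \<open>A matrix and its transpose have the same quadratic form. It splits below into
    two nonnegative forms, both of which must then vanish.\<close>
  then have "z \<bullet> (H *\<^sub>v z) = 0" using transpose_scalar[OF H z z] by simp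
  moreover have w: "transpose_mat B1 *\<^sub>v z \<in> carrier_vec N" "transpose_mat B2 *\<^sub>v z \<in> carrier_vec N"
    "transpose_mat B2 *\<^sub>v f \<in> carrier_vec N"
    using B1 B2 z f by auto
  moreover have "z \<bullet> (H *\<^sub>v z) = (transpose_mat B1 *\<^sub>v z) \<bullet> (P1 *\<^sub>v (transpose_mat B1 *\<^sub>v z))
    + (transpose_mat B2 *\<^sub>v z) \<bullet> (P2 *\<^sub>v (transpose_mat B2 *\<^sub>v z))"
    using z w B1 B2 R1 R2 X.P Y.P
    by (simp add: H_apply scalar_prod_add_distrib[of _ N] transpose_scalar R1_apply R2_apply)
  ultimately have "(transpose_mat B2 *\<^sub>v z) \<bullet> (P2 *\<^sub>v (transpose_mat B2 *\<^sub>v z)) = 0"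
    using X.P_form_nonneg[OF w(1)] Y.P_form_nonneg[OF w(2)] by linarith
  then have "P2 *\<^sub>v (transpose_mat B2 *\<^sub>v z) = 0\<^sub>v N" using Y.P_form_eq_0D w by blast
  \<comment> \<open>Symmetry of \<open>P2\<close> moves it from \<open>f\<close> onto
    \<open>z\<close>, where it yields zero.\<close>
  then have "(transpose_mat B2 *\<^sub>v z) \<bullet> (P2 *\<^sub>v (transpose_mat B2 *\<^sub>v f)) = 0"
    using transpose_scalar[OF Y.P w(2,3)] Y.P_sym w by simp
  then show "z \<bullet> (B2 *\<^sub>v (R2 *\<^sub>v f)) = 0"
    using transpose_scalar[OF B2 z, of "R2 *\<^sub>v f"] R2_apply[OF f] Y.P w by simp
qed

context
  fixes \<mu> :: "real vec"
  assumes \<mu>: "\<mu> \<in> carrier_vec N" and H_\<mu>: "H *\<^sub>v \<mu> = B2 *\<^sub>v (R2 *\<^sub>v f)"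
begin

text \<open>Moving the term with \<open>R2\<close> and \<mu> to the right turns the linear system
  for \<mu> into the coupling constraint for the candidate pair.\<close>

lemma B_R_eq: "B1 *\<^sub>v (R1 *\<^sub>v \<mu>) = B2 *\<^sub>v (R2 *\<^sub>v (f - \<mu>))"
proof -
  have c: "R1 *\<^sub>v \<mu> \<in> carrier_vec N" "R2 *\<^sub>v \<mu> \<in> carrier_vec N" "R2 *\<^sub>v f \<in> carrier_vec N"
    using R1 R2 \<mu> f by auto
  have "B2 *\<^sub>v (R2 *\<^sub>v (f - \<mu>)) = B2 *\<^sub>v (R2 *\<^sub>v f) - B2 *\<^sub>v (R2 *\<^sub>v \<mu>)"
    using c by (simp add: mult_minus_distrib_mat_vec[OF R2 f \<mu>] mult_minus_distrib_mat_vec[OF B2])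
  also have "\<dots> = B1 *\<^sub>v (R1 *\<^sub>v \<mu>)"
    unfolding H_\<mu>[symmetric] H_apply[OF \<mu>] using B1 B2 c by (intro eq_vecI) auto
  finally show ?thesis by simp
qed

lemma admissible_R: "admissible (R1 *\<^sub>v \<mu>, R2 *\<^sub>v (f - \<mu>))"
proof -
  have "f - \<mu> \<in> carrier_vec N" using f \<mu> by simp
  then show ?thesis
    using B_R_eq R1 R2 \<mu> B1 B2 X.P Y.P X.S_P[of "transpose_mat B1 *\<^sub>v \<mu>"]
      Y.S_P[of "transpose_mat B2 *\<^sub>v (f - \<mu>)"] R1_apply[of \<mu>] R2_apply[of "f - \<mu>"]
    by (simp add: admissible_def)
qed

text \<open>The first-order terms cancel: \<open>stationary\<close> turns them into pairings of
  \<mu> and \<open>f - \<mu>\<close> with the increments, and the coupling makes the two \<mu>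
  pairings opposite while the load removes the one with \<open>f\<close>. Since this is an equality,
  it gives both minimality and uniqueness.\<close>

lemma F_expand:
  assumes "admissible (v, w)"
  shows "F (v, w) = F (R1 *\<^sub>v \<mu>, R2 *\<^sub>v (f - \<mu>)) +
    (K1 *\<^sub>v (v - R1 *\<^sub>v \<mu>)) \<bullet> (v - R1 *\<^sub>v \<mu>) +
    (K2 *\<^sub>v (w - R2 *\<^sub>v (f - \<mu>))) \<bullet> (w - R2 *\<^sub>v (f - \<mu>))"
proof -
  define a where "a = R1 *\<^sub>v \<mu>"
  define b where "b = R2 *\<^sub>v (f - \<mu>)"
  have f\<mu>: "f - \<mu> \<in> carrier_vec N" using f \<mu> by simp
  have v: "v \<in> carrier_vec N" and w: "w \<in> carrier_vec N" and "B1 *\<^sub>v v = B2 *\<^sub>v w"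
    "S1 *\<^sub>v v = 0\<^sub>v m" "S2 *\<^sub>v w = 0\<^sub>v m"
    using assms by (auto simp: admissible_def)
  have a: "a \<in> carrier_vec N" and b: "b \<in> carrier_vec N" and "B1 *\<^sub>v a = B2 *\<^sub>v b"
    "S1 *\<^sub>v a = 0\<^sub>v m" "S2 *\<^sub>v b = 0\<^sub>v m"
    using admissible_R by (auto simp: admissible_def a_def b_def)
  have va: "v - a \<in> carrier_vec N" and wb: "w - b \<in> carrier_vec N" using v w a b by auto
  have B: "B1 *\<^sub>v (v - a) = B2 *\<^sub>v (w - b)"
    using \<open>B1 *\<^sub>v v = B2 *\<^sub>v w\<close> \<open>B1 *\<^sub>v a = B2 *\<^sub>v b\<close>
    by (simp add: mult_minus_distrib_mat_vec[OF B1 v a] mult_minus_distrib_mat_vec[OF B2 w b])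
  have S: "S1 *\<^sub>v (v - a) = 0\<^sub>v m" "S2 *\<^sub>v (w - b) = 0\<^sub>v m"
    using \<open>S1 *\<^sub>v v = 0\<^sub>v m\<close> \<open>S2 *\<^sub>v w = 0\<^sub>v m\<close> \<open>S1 *\<^sub>v a = 0\<^sub>v m\<close> \<open>S2 *\<^sub>v b = 0\<^sub>v m\<close>
    by (auto simp: mult_minus_distrib_mat_vec[OF S1 v a] mult_minus_distrib_mat_vec[OF S2 w b])
  have Bc: "B2 *\<^sub>v (w - b) \<in> carrier_vec N" using B2 wb by simp
  \<comment> \<open>The coupling replaces \<open>B1 (v - a)\<close> by \<open>B2 (w - b)\<close>, so
    that this term cancels against the \<mu> part of the next one.\<close>
  have "(K1 *\<^sub>v a) \<bullet> (v - a) = \<mu> \<bullet> (B2 *\<^sub>v (w - b))"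
    using X.stationary[OF _ va S(1), of "transpose_mat B1 *\<^sub>v \<mu>"] B1 \<mu>
      transpose_scalar[OF B1 \<mu> va] B by (simp add: a_def R1_apply)
  moreover have "(K2 *\<^sub>v b) \<bullet> (w - b) = (f - \<mu>) \<bullet> (B2 *\<^sub>v (w - b))"
    using Y.stationary[OF _ wb S(2), of "transpose_mat B2 *\<^sub>v (f - \<mu>)"] B2 f\<mu>
      transpose_scalar[OF B2 f\<mu> wb] by (simp add: b_def R2_apply)
  moreover have "(f - \<mu>) \<bullet> (B2 *\<^sub>v (w - b)) = f \<bullet> (B2 *\<^sub>v (w - b)) - \<mu> \<bullet> (B2 *\<^sub>v (w - b))"
    using minus_scalar_prod_distrib[OF f \<mu> Bc] .
  moreover have "f \<bullet> (B2 *\<^sub>v (w - b)) = (B2 *\<^sub>v w) \<bullet> f - (B2 *\<^sub>v b) \<bullet> f"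
    using comm_scalar_prod[OF f Bc] B2 w b f
    by (simp add: mult_minus_distrib_mat_vec[OF B2 w b] minus_scalar_prod_distrib[of _ N])
  moreover note X.K_form_expand[OF a v] Y.K_form_expand[OF b w]
  ultimately show ?thesis
    by (simp add: F_def a_def[symmetric] b_def[symmetric])
qed

text \<open>In \<open>F_expand\<close> both remainders are nonnegative, and a competitor with no
  larger energy forces them to vanish, hence the increments too by positive definiteness. As \<mu>
  is an arbitrary solution, all solutions give the same pair.\<close>

lemma is_arg_min_iff:
  "is_arg_min F admissible u \<longleftrightarrow> u = (R1 *\<^sub>v \<mu>, R2 *\<^sub>v (f - \<mu>))"
proof
  have c: "R1 *\<^sub>v \<mu> \<in> carrier_vec N" "R2 *\<^sub>v (f - \<mu>) \<in> carrier_vec N"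
    using R1 R2 f \<mu> by auto
  assume min: "is_arg_min F admissible u"
  obtain v w where u: "u = (v, w)" by fastforce
  have ad: "admissible (v, w)" and le: "F (v, w) \<le> F (R1 *\<^sub>v \<mu>, R2 *\<^sub>v (f - \<mu>))"
    using min admissible_R by (auto simp: is_arg_min_linorder u)
  have v: "v \<in> carrier_vec N" and w: "w \<in> carrier_vec N" using ad by (auto simp: admissible_def)
  have d: "v - R1 *\<^sub>v \<mu> \<in> carrier_vec N" "w - R2 *\<^sub>v (f - \<mu>) \<in> carrier_vec N"
    using v w c by auto
  have "v - R1 *\<^sub>v \<mu> = 0\<^sub>v N" "w - R2 *\<^sub>v (f - \<mu>) = 0\<^sub>v N"
    using F_expand[OF ad] le X.K_nonneg[OF d(1)] Y.K_nonneg[OF d(2)]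
      X.K_pos[OF d(1)] Y.K_pos[OF d(2)] by fastforce+
  then have "v = R1 *\<^sub>v \<mu>" "w = R2 *\<^sub>v (f - \<mu>)"
    using eq_of_minus_eq_0[OF v c(1)] eq_of_minus_eq_0[OF w c(2)] by auto
  then show "u = (R1 *\<^sub>v \<mu>, R2 *\<^sub>v (f - \<mu>))" by (simp add: u)
next
  assume u: "u = (R1 *\<^sub>v \<mu>, R2 *\<^sub>v (f - \<mu>))"
  have "F u \<le> F (v, w)" if ad: "admissible (v, w)" for v w
  proof -
    have "v - R1 *\<^sub>v \<mu> \<in> carrier_vec N" "w - R2 *\<^sub>v (f - \<mu>) \<in> carrier_vec N"
      using ad R1 R2 f \<mu> by (auto simp: admissible_def)
    then show ?thesis
      using F_expand[OF ad] X.K_nonneg Y.K_nonneg by (fastforce simp: u)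
  qed
  then show "is_arg_min F admissible u"
    using admissible_R by (auto simp: is_arg_min_linorder u)
qed

end

end

section \<open>Diagonal matrices and averaging along grid lines\<close>

lemma mat_diag_mult_vec:
  assumes "v \<in> carrier_vec N"
  shows "mat_diag N g *\<^sub>v v = vec N (\<lambda>i. g i * v $ i)"
proof (rule eq_vecI)
  fix i assume "i < dim_vec (vec N (\<lambda>i. g i * v $ i))"
  then have i: "i < N" by simp
  have "(mat_diag N g *\<^sub>v v) $ i = (\<Sum>j<N. (if i = j then g j else 0) * v $ j)"
    using i assms by (simp add: mat_diag_def scalar_prod_def lessThan_atLeast0)
  also have "\<dots> = (\<Sum>j<N. if i = j then g j * v $ j else 0)" by (intro sum.cong) auto
  finally show "(mat_diag N g *\<^sub>v v) $ i = vec N (\<lambda>i. g i * v $ i) $ i" using i by simp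
qed (simp add: mat_diag_def)

text \<open>Exhibiting an inverse rules out the result \<open>None\<close> of
  \<open>mat_inverse\<close>, where \<open>minv\<close> would be unspecified; uniqueness of inverses
  then identifies the value.\<close>

lemma minv_mat_diag:
  assumes "\<And>i. i < N \<Longrightarrow> g i \<noteq> 0"
  shows "minv (mat_diag N g) = mat_diag N (\<lambda>i. 1 / g i)"
proof -
  let ?G = "mat_diag N g" and ?I = "mat_diag N (\<lambda>i. 1 / g i)"
  have G: "?G \<in> carrier_mat N N" and I: "?I \<in> carrier_mat N N" by simp_all
  have inv: "?G * ?I = 1\<^sub>m N" "?I * ?G = 1\<^sub>m N"
    using assms unfolding mat_diag_diag by (auto simp: mat_diag_def intro!: eq_matI)
  then have "\<exists>M\<in>carrier_mat N N. M * ?G = 1\<^sub>m N \<and> ?G * M = 1\<^sub>m N" using I by blast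
  then have "?G \<in> Units (ring_mat TYPE(real) N undefined)"
    by (simp add: Units_def ring_mat_def)
  then obtain M where M: "mat_inverse ?G = Some M"
    using mat_inverse(1)[OF G, where b = undefined] by fastforce
  then have "M * ?G = 1\<^sub>m N" "M \<in> carrier_mat N N" using mat_inverse(2)[OF G] by auto
  then have "M = ?I"
    using assoc_mult_mat[OF _ G I, of M N] inv I by (simp del: mat_diag_diag)
  with M show ?thesis by (simp add: minv_def)
qed

(* Both directions of the grid are covered at once: c sends an unknown to the grid line on which
   the constraint sums it, that is c = (div n) for x and c = (mod n) for y. *)
lemma constrained_inverse_averaging:
  fixes k q :: "nat \<Rightarrow> real" and c :: "nat \<Rightarrow> nat"
  assumes k: "\<And>a. a < N \<Longrightarrow> 0 < k a" and c: "\<And>a. a < N \<Longrightarrow> c a < m"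
    and q: "\<And>i. i < m \<Longrightarrow> q i * (\<Sum>a<N. if c a = i then 1 / k a else 0) = 1"
  defines "S \<equiv> mat m N (\<lambda>(i, b). if i = c b then 1 else 0)"
    and "W \<equiv> mat N N (\<lambda>(a, b). if c a = c b then q (c a) else 0)"
    and "J \<equiv> mat_diag N (\<lambda>a. 1 / k a)"
  shows "constrained_inverse N m (mat_diag N k) S (J * (1\<^sub>m N - W * J))"
proof -
  \<comment> \<open>The entries of \<open>J * (1 - W * J)\<close>. On each line, applying them
    divides a vector by \<open>k\<close> and subtracts the multiple of \<open>1 / k\<close> that
    makes the line sum zero.\<close>
  define p where "p a b = (if a = b then 1 / k a else 0) -
    (if c a = c b then q (c a) / (k a * k b) else 0)" for a b
  define P where "P = mat N N (\<lambda>(a, b). p a b)"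
  have W: "W \<in> carrier_mat N N" and S: "S \<in> carrier_mat m N" and P: "P \<in> carrier_mat N N"
    by (simp_all add: W_def S_def P_def)
  have "J * (1\<^sub>m N - W * J) = P"
    unfolding J_def mat_diag_mult_right[OF W]
    by (subst mat_diag_mult_left[of _ N N])
      (auto simp: P_def p_def W_def algebra_simps diff_divide_distrib intro!: eq_matI)
  moreover have "constrained_inverse N m (mat_diag N k) S P"
  proof
    show "transpose_mat (mat_diag N k) = mat_diag N k"
      by (auto simp: mat_diag_def intro!: eq_matI)
    show "transpose_mat P = P"
      by (auto simp: P_def p_def intro!: eq_matI)
  next
    fix v :: "real vec" assume v: "v \<in> carrier_vec N" and "v \<noteq> 0\<^sub>v N"
    then obtain i where i: "i < N" "v $ i \<noteq> 0" by (metis carrier_vecD eq_vecI index_zero_vec)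
    have "(mat_diag N k *\<^sub>v v) \<bullet> v = (\<Sum>a<N. k a * (v $ a)\<^sup>2)"
      using v by (simp add: mat_diag_mult_vec scalar_prod_def power2_eq_square
          lessThan_atLeast0 mult.assoc)
    also have "\<dots> > 0" using i k by (intro sum_pos2[of _ i]) (auto simp: less_imp_le)
    finally show "0 < (mat_diag N k *\<^sub>v v) \<bullet> v" .
  next
    fix v :: "real vec" assume v: "v \<in> carrier_vec N"
    have "S * P = 0\<^sub>m m N"
    proof (rule eq_matI)
      fix i b assume "i < dim_row (0\<^sub>m m N :: real mat)" "b < dim_col (0\<^sub>m m N :: real mat)"
      then have i: "i < m" and b: "b < N" by auto
      have "(S * P) $$ (i, b) = (\<Sum>a<N. (if i = c a then 1 else 0) * p a b)"
        using i b by (simp add: S_def P_def scalar_prod_def lessThan_atLeast0)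
      also have "\<dots> = (\<Sum>a<N. (if a = b then if i = c b then 1 / k b else 0 else 0) -
          (if i = c b then q i / k b else 0) * (if c a = i then 1 / k a else 0))"
        by (intro sum.cong) (auto simp: p_def)
      also have "\<dots> = (if i = c b then 1 / k b else 0) -
          (if i = c b then q i / k b else 0) * (\<Sum>a<N. if c a = i then 1 / k a else 0)"
        using b by (simp add: sum_subtractf sum_distrib_left)
      \<comment> \<open>Here \<open>q i\<close> enters as the reciprocal of the sum of
        \<open>1 / k\<close> over line \<open>i\<close>.\<close>
      also have "\<dots> = 0" using q[OF i] by (cases "i = c b") simp_all
      finally show "(S * P) $$ (i, b) = 0\<^sub>m m N $$ (i, b)" using i b by simp
    qed (use S P in auto)
    then show "S *\<^sub>v (P *\<^sub>v v) = 0\<^sub>v m"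
      unfolding assoc_mult_mat_vec[OF S P v, symmetric] using v by (auto intro!: eq_vecI)
  next
    fix v :: "real vec" assume v: "v \<in> carrier_vec N" and Sv: "S *\<^sub>v v = 0\<^sub>v m"
    show "P *\<^sub>v (mat_diag N k *\<^sub>v v) = v"
    proof (rule eq_vecI)
      fix a assume "a < dim_vec v"
      then have a: "a < N" using v by simp
      have ka: "k b \<noteq> 0" if "b < N" for b using k[OF that] by simp
      have "(S *\<^sub>v v) $ c a = 0" using Sv c[OF a] by simp
      \<comment> \<open>The constraint row of the line through \<open>a\<close>. Since
        \<open>P K v\<close> differs from \<open>v\<close> at \<open>a\<close> only by a multiple of
        this line sum, the correction disappears.\<close>
      then have 0: "(\<Sum>b<N. (if c a = c b then 1 else 0) * v $ b) = 0"
        using v c[OF a] by (simp add: S_def scalar_prod_def lessThan_atLeast0)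
      have "(P *\<^sub>v (mat_diag N k *\<^sub>v v)) $ a = (\<Sum>b<N. p a b * (k b * v $ b))"
        using v a by (simp add: P_def mat_diag_mult_vec scalar_prod_def lessThan_atLeast0)
      also have "\<dots> = (\<Sum>b<N. (if a = b then v $ b else 0) -
          q (c a) / k a * ((if c a = c b then 1 else 0) * v $ b))"
        using ka by (intro sum.cong) (auto simp: p_def field_simps)
      also have "\<dots> = v $ a - q (c a) / k a * (\<Sum>b<N. (if c a = c b then 1 else 0) * v $ b)"
        using a unfolding sum_subtractf sum_distrib_left[symmetric] by simp
      finally show "(P *\<^sub>v (mat_diag N k *\<^sub>v v)) $ a = v $ a" using 0 by simp
    qed (use v P in simp)
  qed (use P in auto)
  ultimately show ?thesis by simp
qed

section \<open>Kronecker products in grid coordinates\<close>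

lemma grid_index_less:
  fixes a n :: nat
  assumes "a < n * n"
  shows "a div n < n" "a mod n < n"
proof -
  have "0 < n" using assms by (cases n) auto
  then show "a div n < n" "a mod n < n" using assms by (auto simp: less_mult_imp_div_less)
qed

lemma grid_point_less:
  fixes i j n :: nat
  assumes "i < n" "j < n"
  shows "i * n + j < n\<^sup>2" "j + n * i < n\<^sup>2"
proof -
  have "i * n + j < Suc i * n" using assms by simp
  also have "\<dots> \<le> n * n" using assms by (intro mult_le_mono1) simp
  finally show "i * n + j < n\<^sup>2" "j + n * i < n\<^sup>2" by (simp_all add: power2_eq_square ac_simps)
qed

lemma kron_one_one: "1\<^sub>m n \<otimes>\<^sub>K 1\<^sub>m n = 1\<^sub>m (n\<^sup>2)"
  by (rule eq_matI)
    (auto simp: kron_def power2_eq_square grid_index_less, metis div_mult_mod_eq)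

text \<open>The x coordinate is the fast index \<open>b mod n\<close>, so a line in the x direction
  is a block with common \<open>b div n\<close>; in the y direction the roles are exchanged. The
  form matches \<open>S\<close> in \<open>constrained_inverse_averaging\<close>.\<close>

lemma S_x_eq: "S_x n = mat n (n\<^sup>2) (\<lambda>(i, b). if i = b div n then 1 else 0)"
  by (rule eq_matI)
    (auto simp: S_x_def kron_def ones_col_def power2_eq_square grid_index_less)

lemma S_y_eq: "S_y n = mat n (n\<^sup>2) (\<lambda>(i, b). if i = b mod n then 1 else 0)"
  by (rule eq_matI)
    (auto simp: S_y_def kron_def ones_col_def power2_eq_square grid_index_less)

lemma W_x_eq:
  "W_x n k = mat (n\<^sup>2) (n\<^sup>2) (\<lambda>(a, b). if a div n = b div n then q_x_vec n k $ (a div n) else 0)"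
  by (rule eq_matI)
    (auto simp: W_x_def Q_x_def diag_of_vec_def q_x_vec_def mat_diag_def kron_def ones_mat_def
      power2_eq_square grid_index_less)

lemma W_y_eq:
  "W_y n k = mat (n\<^sup>2) (n\<^sup>2) (\<lambda>(a, b). if a mod n = b mod n then q_y_vec n k $ (a mod n) else 0)"
  by (rule eq_matI)
    (auto simp: W_y_def Q_y_def diag_of_vec_def q_y_vec_def mat_diag_def kron_def ones_mat_def
      power2_eq_square grid_index_less)

lemma B_x_carrier: "B_x n \<in> carrier_mat (n\<^sup>2) (n\<^sup>2)"
  and B_y_carrier: "B_y n \<in> carrier_mat (n\<^sup>2) (n\<^sup>2)"
  by (auto simp: B_x_def B_y_def kron_def B_mat_def power2_eq_square)

text \<open>Reconciles the line sum over all unknowns in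
  \<open>constrained_inverse_averaging\<close> with the local numbering in \<open>q_x_vec\<close>;
  \<open>sum_mod_eq\<close> does so for \<open>q_y_vec\<close>.\<close>

lemma sum_div_eq:
  fixes g :: "nat \<Rightarrow> real"
  assumes "i < n"
  shows "(\<Sum>a<n\<^sup>2. if a div n = i then g a else 0) = (\<Sum>a<n. g (i * n + a))"
proof -
  have lt: "i * n + a < n\<^sup>2" if "a < n" for a
    using assms that by (rule grid_point_less)
  have "(\<Sum>a<n\<^sup>2. if a div n = i then g a else 0) = sum g {a \<in> {..<n\<^sup>2}. a div n = i}"
    by (simp only: sum.inter_filter finite_lessThan)
  also have "\<dots> = (\<Sum>a<n. g (i * n + a))"
    using assms lt
    by (intro sum.reindex_bij_witness[of _ "\<lambda>a. i * n + a" "\<lambda>a. a mod n"]) auto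
  finally show ?thesis .
qed

lemma sum_mod_eq:
  fixes g :: "nat \<Rightarrow> real"
  assumes "i < n"
  shows "(\<Sum>a<n\<^sup>2. if a mod n = i then g a else 0) = (\<Sum>a<n. g (i + n * a))"
proof -
  have lt: "i + n * a < n\<^sup>2" if "a < n" for a
    using that assms by (rule grid_point_less)
  have "(\<Sum>a<n\<^sup>2. if a mod n = i then g a else 0) = sum g {a \<in> {..<n\<^sup>2}. a mod n = i}"
    by (simp only: sum.inter_filter finite_lessThan)
  also have "\<dots> = (\<Sum>a<n. g (i + n * a))"
    using assms lt
    by (intro sum.reindex_bij_witness[of _ "\<lambda>a. i + n * a" "\<lambda>a. a div n"])
      (auto simp: power2_eq_square less_mult_imp_div_less)
  finally show ?thesis .
qed

section \<open>Sampled coefficients and the two grid directions\<close>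

text \<open>Positivity of the coefficients is known only on \<open>Omega\<close>, so the sample
  points must be located there; the offset \<open>t\<close> will be \<open>1/2\<close> or
  \<open>1\<close>.\<close>

lemma mesh_point_in_unit_interval:
  assumes "i < n" "0 \<le> t" "t \<le> 1"
  shows "(real i + t) * mesh n \<in> {0..1}"
  using assms by (auto simp: mesh_def divide_le_eq)

lemma k_x_vec_pos:
  assumes "\<forall>p\<in>Omega. 0 < k p" "a < n\<^sup>2"
  shows "0 < k_x_vec n k $ a"
  using assms mesh_point_in_unit_interval[of "a mod n" n "1/2"]
    mesh_point_in_unit_interval[of "a div n" n 1]
  by (auto simp: k_x_vec_def Omega_def power2_eq_square grid_index_less)

lemma k_y_vec_pos:
  assumes "\<forall>p\<in>Omega. 0 < k p" "a < n\<^sup>2"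
  shows "0 < k_y_vec n k $ a"
  using assms mesh_point_in_unit_interval[of "a mod n" n 1]
    mesh_point_in_unit_interval[of "a div n" n "1/2"]
  by (auto simp: k_y_vec_def Omega_def power2_eq_square grid_index_less)

lemma constrained_inverse_x:
  assumes "\<forall>p\<in>Omega. 0 < k p"
  shows "constrained_inverse (n\<^sup>2) n (K_x n k) (S_x n)
    (minv (K_x n k) * (1\<^sub>m n \<otimes>\<^sub>K 1\<^sub>m n - W_x n k * minv (K_x n k)))"
proof -
  note pos = k_x_vec_pos[OF assms]
  have K: "K_x n k = mat_diag (n\<^sup>2) (\<lambda>a. k_x_vec n k $ a)"
    by (simp add: K_x_def diag_of_vec_def k_x_vec_def)
  have J: "minv (K_x n k) = mat_diag (n\<^sup>2) (\<lambda>a. 1 / k_x_vec n k $ a)"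
    unfolding K using pos by (intro minv_mat_diag) (simp add: less_imp_neq[THEN not_sym])
  have q: "q_x_vec n k $ i * (\<Sum>a<n\<^sup>2. if a div n = i then 1 / k_x_vec n k $ a else 0) = 1"
    if i: "i < n" for i
  proof -
    have "i * n + a < n\<^sup>2" if "a < n" for a
      using i that by (rule grid_point_less)
    \<comment> \<open>A nonzero sum makes \<open>q_x_vec\<close> a true reciprocal rather than the
      default \<open>inverse 0 = 0\<close>; \<open>i < n\<close> makes the sum nonempty.\<close>
    then have "0 < (\<Sum>a<n. 1 / k_x_vec n k $ (i * n + a))"
      using i pos by (intro sum_pos) auto
    then show ?thesis using i by (simp add: sum_div_eq q_x_vec_def)
  qed
  show ?thesis
    unfolding J unfolding K kron_one_one S_x_eq W_x_eq
    by (intro constrained_inverse_averaging pos q) (auto simp: power2_eq_square grid_index_less)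
qed

lemma constrained_inverse_y:
  assumes "\<forall>p\<in>Omega. 0 < k p"
  shows "constrained_inverse (n\<^sup>2) n (K_y n k) (S_y n)
    (minv (K_y n k) * (1\<^sub>m n \<otimes>\<^sub>K 1\<^sub>m n - W_y n k * minv (K_y n k)))"
proof -
  note pos = k_y_vec_pos[OF assms]
  have K: "K_y n k = mat_diag (n\<^sup>2) (\<lambda>a. k_y_vec n k $ a)"
    by (simp add: K_y_def diag_of_vec_def k_y_vec_def)
  have J: "minv (K_y n k) = mat_diag (n\<^sup>2) (\<lambda>a. 1 / k_y_vec n k $ a)"
    unfolding K using pos by (intro minv_mat_diag) (simp add: less_imp_neq[THEN not_sym])
  have q: "q_y_vec n k $ i * (\<Sum>a<n\<^sup>2. if a mod n = i then 1 / k_y_vec n k $ a else 0) = 1"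
    if i: "i < n" for i
  proof -
    have "i + n * a < n\<^sup>2" if "a < n" for a
      using that i by (rule grid_point_less)
    then have "0 < (\<Sum>a<n. 1 / k_y_vec n k $ (i + n * a))"
      using i pos by (intro sum_pos) auto
    then show ?thesis using i by (simp add: sum_mod_eq q_y_vec_def)
  qed
  show ?thesis
    unfolding J unfolding K kron_one_one S_y_eq W_y_eq
    by (intro constrained_inverse_averaging pos q) (auto simp: power2_eq_square grid_index_less)
qed

theorem theorem2p1:
  fixes d n :: nat and k\<^sub>x k\<^sub>y f :: "real \<times> real \<Rightarrow> real"
  assumes "n = 2 ^ d"
    and "\<forall>p\<in>Omega. k\<^sub>x p > 0"
    and "\<forall>p\<in>Omega. k\<^sub>y p > 0"
  shows "(\<exists>!u. is_arg_min (energy n k\<^sub>x k\<^sub>y f) (feasible n) u) \<and>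
    (\<exists>\<mu>\<in>carrier_vec (n\<^sup>2).
       (H_x n k\<^sub>x + H_y n k\<^sub>y) *\<^sub>v \<mu> = H_y n k\<^sub>y *\<^sub>v f_vec n f) \<and>
    (\<forall>\<mu>\<in>carrier_vec (n\<^sup>2).
       (H_x n k\<^sub>x + H_y n k\<^sub>y) *\<^sub>v \<mu> = H_y n k\<^sub>y *\<^sub>v f_vec n f \<longrightarrow>
       (\<forall>u\<^sub>x u\<^sub>y. is_arg_min (energy n k\<^sub>x k\<^sub>y f) (feasible n) (u\<^sub>x, u\<^sub>y) \<longrightarrow>
          u\<^sub>x = R_x n k\<^sub>x *\<^sub>v \<mu> \<and>
          u\<^sub>y = R_y n k\<^sub>y *\<^sub>v (f_vec n f - \<mu>) \<and>
          B_x n *\<^sub>v u\<^sub>x = H_x n k\<^sub>x *\<^sub>v \<mu> \<and>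
          B_y n *\<^sub>v u\<^sub>y = H_x n k\<^sub>x *\<^sub>v \<mu>))"
proof -
  let ?P1 = "minv (K_x n k\<^sub>x) * (1\<^sub>m n \<otimes>\<^sub>K 1\<^sub>m n - W_x n k\<^sub>x * minv (K_x n k\<^sub>x))"
  let ?P2 = "minv (K_y n k\<^sub>y) * (1\<^sub>m n \<otimes>\<^sub>K 1\<^sub>m n - W_y n k\<^sub>y * minv (K_y n k\<^sub>y))"
  \<comment> \<open>Each direction has \<open>n\<^sup>2\<close> unknowns and \<open>n\<close> grid
    lines, one constraint per line.\<close>
  interpret C: coupled_minimization "n\<^sup>2" n "K_x n k\<^sub>x" "S_x n" ?P1 "K_y n k\<^sub>y" "S_y n" ?P2
    "B_x n" "B_y n" "f_vec n f"
    using constrained_inverse_x[OF assms(2)] constrained_inverse_y[OF assms(3)]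
    by (intro coupled_minimization.intro coupled_minimization_axioms.intro)
      (simp_all add: B_x_carrier B_y_carrier S_x_eq S_y_eq f_vec_def)
  have R: "C.R1 = R_x n k\<^sub>x" "C.R2 = R_y n k\<^sub>y"
    by (simp_all add: C.R1_def C.R2_def R_x_def R_y_def)
  have H: "C.H = H_x n k\<^sub>x + H_y n k\<^sub>y" by (simp add: C.H_def H_x_def H_y_def R)
  have E: "C.F = energy n k\<^sub>x k\<^sub>y f" by (simp add: C.F_def energy_def)
  have A: "C.admissible = feasible n" by (simp add: C.admissible_def feasible_def)
  note carriers = B_x_carrier[of n] B_y_carrier[of n] C.R1[unfolded R] C.R2[unfolded R] C.f
  have Hx: "H_x n k\<^sub>x *\<^sub>v z = B_x n *\<^sub>v (R_x n k\<^sub>x *\<^sub>v z)"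
    and Hy: "H_y n k\<^sub>y *\<^sub>v z = B_y n *\<^sub>v (R_y n k\<^sub>y *\<^sub>v z)" if "z \<in> carrier_vec (n\<^sup>2)" for z
    using carriers that
    by (auto simp: H_x_def H_y_def intro!: assoc_mult_mat_vec[of _ "n\<^sup>2" "n\<^sup>2" _ "n\<^sup>2"])
  \<comment> \<open>One fixed solution settles existence and uniqueness of the minimizer; the
    formulas are then derived for an arbitrary one.\<close>
  obtain \<mu>0 where \<mu>0: "\<mu>0 \<in> carrier_vec (n\<^sup>2)"
    "(H_x n k\<^sub>x + H_y n k\<^sub>y) *\<^sub>v \<mu>0 = H_y n k\<^sub>y *\<^sub>v f_vec n f"
    using C.multiplier_exists by (auto simp: H R Hy C.f)
  have min_iff: "is_arg_min (energy n k\<^sub>x k\<^sub>y f) (feasible n) u \<longleftrightarrow>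
      u = (R_x n k\<^sub>x *\<^sub>v \<mu>, R_y n k\<^sub>y *\<^sub>v (f_vec n f - \<mu>))"
    and B_eq: "B_x n *\<^sub>v (R_x n k\<^sub>x *\<^sub>v \<mu>) = B_y n *\<^sub>v (R_y n k\<^sub>y *\<^sub>v (f_vec n f - \<mu>))"
    if "\<mu> \<in> carrier_vec (n\<^sup>2)" "(H_x n k\<^sub>x + H_y n k\<^sub>y) *\<^sub>v \<mu> = H_y n k\<^sub>y *\<^sub>v f_vec n f" for \<mu> u
    using C.is_arg_min_iff[of \<mu> u] C.B_R_eq[of \<mu>] that by (simp_all add: H R E A Hy C.f)
  show ?thesis
  proof (intro conjI ballI impI allI)
    show "\<exists>!u. is_arg_min (energy n k\<^sub>x k\<^sub>y f) (feasible n) u"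
      unfolding min_iff[OF \<mu>0] by simp
    show "\<exists>\<mu>\<in>carrier_vec (n\<^sup>2). (H_x n k\<^sub>x + H_y n k\<^sub>y) *\<^sub>v \<mu> = H_y n k\<^sub>y *\<^sub>v f_vec n f"
      using \<mu>0 by blast
  next
    fix \<mu> u\<^sub>x u\<^sub>y
    assume \<mu>: "\<mu> \<in> carrier_vec (n\<^sup>2)"
      "(H_x n k\<^sub>x + H_y n k\<^sub>y) *\<^sub>v \<mu> = H_y n k\<^sub>y *\<^sub>v f_vec n f"
      and "is_arg_min (energy n k\<^sub>x k\<^sub>y f) (feasible n) (u\<^sub>x, u\<^sub>y)"
    then show ux: "u\<^sub>x = R_x n k\<^sub>x *\<^sub>v \<mu>" and uy: "u\<^sub>y = R_y n k\<^sub>y *\<^sub>v (f_vec n f - \<mu>)"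
      using min_iff[OF \<mu>] by blast+
    show "B_x n *\<^sub>v u\<^sub>x = H_x n k\<^sub>x *\<^sub>v \<mu>" using Hx[OF \<mu>(1)] ux by simp
    show "B_y n *\<^sub>v u\<^sub>y = H_x n k\<^sub>x *\<^sub>v \<mu>" using Hx[OF \<mu>(1)] B_eq[OF \<mu>] uy by simp
  qed
qed

end
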